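(* Let $N\ge 1$ be an integer, $a>0$, and let $F\colon\mathbb{R}\to\mathbb{R}$ satisfy the following. (F0) $F\in C^1(\mathbb{R})$ and: if $N=1$, there is $S>0$ with $|F'(t)|\le S|t|$ for all $t\in[-1,1]$; if $N=2$, for every $b>0$ there is $S_b>0$ with $|F'(t)|\le S_b(|t|+e^{bt^2}-1)$ for all $t\in\mathbb{R}$; if $N\ge3$, there is $S>0$ with $|F'(t)|\le S(|t|+|t|^{2^*-1})$ for all $t\in\mathbb{R}$. (F1) $\eta_\infty:=\limsup_{|t|\to\infty}F(t)/|t|^{2_\#}<\infty$. (F2) $\lim_{t\to0}F(t)/t^2=0$. (F3) $\eta_0:=\liminf_{t\to0}F(t)/|t|^{2_\#}>0$ (with $\eta_0=\infty$ allowed). Assume that $2\eta_\infty C_{N,2_\#}^{2_\#}a^{4/N}<1$ and $2\eta_0C_{N,2_\#}^{2_\#}a^{4/N}>1$, and that at least one of the following holds: $N\ge2$, or $F'$ is locally Lipschitz continuous, or $F$ is even. Let $(\lambda,u)\in(0,\infty)\times\mathcal{S}$ be such that $-\Delta u+\lambda u=F'(u)$ in $\mathbb{R}^N$ and $0>J(u)=\inf_{\mathcal{D}}J=\inf_{\mathcal{S}}J$, where $u$ (which has constant sign) is translated so as to be radial and radially monotone. If $F$ is nondecreasing on $[0,\infty)$ and nonincreasing on $(-\infty,0]$, then $|u|>0$ on $\mathbb{R}^N$. If, moreover, there exist $t_0,t^0>0$ such that $F'(t)\le\lambda t$ for every $t\in[0,t_0]$, $F'(t)>\lambda t$ for every $t>t_0$,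 $F'(t)\ge\lambda t$ for every $t\in[-t^0,0]$, and $F'(t)<\lambda t$ for every $t<-t^0$, then $u$ is radially strictly monotone.
   Context: $2_\#:=2+4/N$; $2^*:=2N/(N-2)$ if $N\ge3$ and $2^*:=\infty$ if $N\in\{1,2\}$. $|\cdot|_p$ is the $L^p(\mathbb{R}^N)$ norm. $C_{N,2_\#}>0$ is the best constant in the Gagliardo--Nirenberg inequality $|u|_{2_\#}\le C_{N,2_\#}|u|_2^{1-\delta}|\nabla u|_2^{\delta}$, $u\in H^1(\mathbb{R}^N)$, with $\delta=N\left(\frac12-\frac1{2_\#}\right)=\frac{N}{N+2}$. Functions are real valued and $$J(u)=\int_{\mathbb{R}^N}\tfrac12|\nabla u|^2-F(u)\,dx,\quad \mathcal{S}=\{u\in H^1(\mathbb{R}^N):|u|_2=a\},\quad \mathcal{D}=\{u\in H^1(\mathbb{R}^N):|u|_2\le a\}.$$ The equation is understood in the weak sense. If $\eta_0=\infty$, the inequality involving $\eta_0$ is regarded as satisfied. Under the stated hypotheses every minimizer of $J|_{\mathcal D}$ has constant sign and is, up to a translation, radial and radially monotone (i.e. $u(x)=\varphi(|x|)$ with $\varphi$ monotone on $[0,\infty)$); radially strictly monotone means $\varphi$ strictly monotone. *)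

theory Defs
  imports "HOL-Analysis.Analysis"
begin

section \<open>Test functions and Sobolev functions on \<open>\<real>\<^sup>N\<close>\<close>

text \<open>
  The space \<open>\<real>\<^sup>N\<close> is \<^typ>\<open>real ^ 'n\<close> with \<open>N = CARD('n)\<close>. Elements of Lebesgue and Sobolev
  spaces are represented by Borel functions (not by classes modulo null sets), and integrals are
  taken with respect to \<^const>\<open>lborel\<close>.
\<close>

definition partial_deriv :: "'n \<Rightarrow> (real ^ 'n \<Rightarrow> real) \<Rightarrow> real ^ 'n::finite \<Rightarrow> real"
  where "partial_deriv i f x = frechet_derivative f (at x) (axis i 1)"

definition gradient :: "(real ^ 'n \<Rightarrow> real) \<Rightarrow> real ^ 'n::finite \<Rightarrow> real ^ 'n"
  where "gradient f x = (\<chi> i. partial_deriv i f x)"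

primrec Ck :: "nat \<Rightarrow> (real ^ 'n::finite \<Rightarrow> real) \<Rightarrow> bool"
  where
    "Ck 0 f \<longleftrightarrow> continuous_on UNIV f"
  | "Ck (Suc k) f \<longleftrightarrow> (\<forall>x. f differentiable (at x)) \<and> (\<forall>i. Ck k (partial_deriv i f))"

definition test_functions :: "(real ^ 'n::finite \<Rightarrow> real) set"
  where "test_functions = {\<phi>. (\<forall>k. Ck k \<phi>) \<and> compact (closure {x. \<phi> x \<noteq> 0})}"

definition Lp_space :: "real \<Rightarrow> (real ^ 'n::finite \<Rightarrow> 'b::euclidean_space) set"
  where "Lp_space p =
    {f \<in> borel_measurable lborel. integrable lborel (\<lambda>x. norm (f x) powr p)}"

text \<open>Meaningful only on \<^const>\<open>Lp_space\<close>: the Bochner integral of a non-integrable function is 0.\<close>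
definition Lp_norm :: "real \<Rightarrow> (real ^ 'n::finite \<Rightarrow> 'b::euclidean_space) \<Rightarrow> real"
  where "Lp_norm p f = (\<integral>x. norm (f x) powr p \<partial>lborel) powr (1 / p)"

definition is_weak_gradient :: "(real ^ 'n \<Rightarrow> real) \<Rightarrow> (real ^ 'n::finite \<Rightarrow> real ^ 'n) \<Rightarrow> bool"
  where "is_weak_gradient u G \<longleftrightarrow>
    (\<forall>\<phi>\<in>test_functions. \<forall>i.
      (\<integral>x. u x * partial_deriv i \<phi> x \<partial>lborel) = - (\<integral>x. G x $ i * \<phi> x \<partial>lborel))"

definition H1 :: "(real ^ 'n::finite \<Rightarrow> real) set"
  where "H1 = {u \<in> Lp_space 2. \<exists>G\<in>Lp_space 2. is_weak_gradient u G}"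

text \<open>The choice is immaterial: the weak gradient is unique up to a null set.\<close>
definition weak_gradient :: "(real ^ 'n::finite \<Rightarrow> real) \<Rightarrow> real ^ 'n \<Rightarrow> real ^ 'n"
  where "weak_gradient u = (SOME G. G \<in> Lp_space 2 \<and> is_weak_gradient u G)"

section \<open>Exponents and the Gagliardo--Nirenberg constant\<close>

definition two_sharp :: "nat \<Rightarrow> real"
  where "two_sharp N = 2 + 4 / real N"

text \<open>Used only for \<open>N \<ge> 3\<close>; the value \<open>\<infinity>\<close> for \<open>N \<in> {1, 2}\<close> is not needed.\<close>
definition two_star :: "nat \<Rightarrow> real"
  where "two_star N = 2 * real N / (real N - 2)"

definition GN_delta :: "nat \<Rightarrow> real"
  where "GN_delta N = real N * (1 / 2 - 1 / two_sharp N)"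

text \<open>
  Admissibility of \<open>C\<close> includes \<open>H1 \<subseteq> L\<^sup>p\<close> for \<open>p = 2 + 4/N\<close>, so that \<^const>\<open>Lp_norm\<close> is the genuine
  norm in the inequality.
\<close>
definition GN_constant :: "'n::finite itself \<Rightarrow> real"
  where "GN_constant (_ :: 'n itself) =
    Inf {C. 0 \<le> C \<and> (\<forall>u \<in> (H1 :: (real ^ 'n \<Rightarrow> real) set).
      u \<in> Lp_space (two_sharp CARD('n)) \<and>
      Lp_norm (two_sharp CARD('n)) u
        \<le> C * Lp_norm 2 u powr (1 - GN_delta CARD('n))
            * Lp_norm 2 (weak_gradient u) powr GN_delta CARD('n))}"

section \<open>The nonlinearity\<close>

definition F0 :: "nat \<Rightarrow> (real \<Rightarrow> real) \<Rightarrow> bool"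
  where "F0 N F \<longleftrightarrow> F C1_differentiable_on UNIV \<and>
    (N = 1 \<longrightarrow> (\<exists>S>0. \<forall>t\<in>{-1..1}. \<bar>deriv F t\<bar> \<le> S * \<bar>t\<bar>)) \<and>
    (N = 2 \<longrightarrow> (\<forall>b>0. \<exists>S>0. \<forall>t. \<bar>deriv F t\<bar> \<le> S * (\<bar>t\<bar> + exp (b * t\<^sup>2) - 1))) \<and>
    (N \<ge> 3 \<longrightarrow> (\<exists>S>0. \<forall>t. \<bar>deriv F t\<bar> \<le> S * (\<bar>t\<bar> + \<bar>t\<bar> powr (two_star N - 1))))"

definition eta_infinity :: "nat \<Rightarrow> (real \<Rightarrow> real) \<Rightarrow> ereal"
  where "eta_infinity N F = Limsup at_infinity (\<lambda>t. ereal (F t / \<bar>t\<bar> powr two_sharp N))"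

definition eta_zero :: "nat \<Rightarrow> (real \<Rightarrow> real) \<Rightarrow> ereal"
  where "eta_zero N F = Liminf (at 0) (\<lambda>t. ereal (F t / \<bar>t\<bar> powr two_sharp N))"

definition locally_lipschitz :: "(real \<Rightarrow> real) \<Rightarrow> bool"
  where "locally_lipschitz f \<longleftrightarrow> (\<forall>t. \<exists>e>0. \<exists>L. L-lipschitz_on (cball t e) f)"

section \<open>The variational problem\<close>

definition energy :: "(real \<Rightarrow> real) \<Rightarrow> (real ^ 'n::finite \<Rightarrow> real) \<Rightarrow> real"
  where "energy F u = (\<integral>x. (1 / 2) * (norm (weak_gradient u x))\<^sup>2 - F (u x) \<partial>lborel)"

definition L2_sphere :: "real \<Rightarrow> (real ^ 'n::finite \<Rightarrow> real) set"
  where "L2_sphere a = {u \<in> H1. Lp_norm 2 u = a}"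

definition L2_ball :: "real \<Rightarrow> (real ^ 'n::finite \<Rightarrow> real) set"
  where "L2_ball a = {u \<in> H1. Lp_norm 2 u \<le> a}"

text \<open>
  Weak formulation of \<open>- \<Delta>u + \<mu> u = f(u)\<close> for \<open>u \<in> H1\<close>. The integrability clause says that \<open>f(u)\<close>
  acts on test functions by integration; it is needed since non-integrable functions have Bochner
  integral 0.
\<close>
definition weak_solution :: "real \<Rightarrow> (real \<Rightarrow> real) \<Rightarrow> (real ^ 'n::finite \<Rightarrow> real) \<Rightarrow> bool"
  where "weak_solution \<mu> f u \<longleftrightarrow> u \<in> H1 \<and>
    (\<forall>\<phi>\<in>test_functions.
      integrable lborel (\<lambda>x. f (u x) * \<phi> x) \<and>
      (\<integral>x. weak_gradient u x \<bullet> gradient \<phi> x + \<mu> * u x * \<phi> x \<partial>lborel)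
        = (\<integral>x. f (u x) * \<phi> x \<partial>lborel))"

definition radially_monotone :: "(real ^ 'n::finite \<Rightarrow> real) \<Rightarrow> bool"
  where "radially_monotone u \<longleftrightarrow>
    (\<exists>\<phi>. (\<forall>x. u x = \<phi> (norm x)) \<and> (mono_on {0..} \<phi> \<or> antimono_on {0..} \<phi>))"

definition radially_strictly_monotone :: "(real ^ 'n::finite \<Rightarrow> real) \<Rightarrow> bool"
  where "radially_strictly_monotone u \<longleftrightarrow>
    (\<exists>\<phi>. (\<forall>x. u x = \<phi> (norm x)) \<and> (strict_mono_on {0..} \<phi> \<or> strict_antimono_on {0..} \<phi>))"

end

theory Submission imports Defs begin

text \<open>
  The main tool is a strong maximum principle for distributional supersolutions. If \<open>w \<ge> 0\<close> satisfies \<open>\<Delta>w \<le> \<mu>w\<close> and vanishes on a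
  ball of radius \<open>\<delta>\<close>, test with \<open>\<psi>(x) = exp (- 1 / (\<rho>\<^sup>2 - \<bar>x - y\<bar>\<^sup>2))\<close> for \<open>\<rho>\<close> slightly larger than \<open>\<delta>\<close>:
  on \<open>\<delta> \<le> \<bar>x - y\<bar> < \<rho>\<close> one has \<open>\<Delta>\<psi> > \<mu>\<psi>\<close>, so \<open>w\<close> vanishes on the larger ball as well.

  Let \<open>u\<close> be nonincreasing in \<open>\<bar>x\<bar>\<close>; then \<open>u \<ge> 0\<close> since \<open>u \<in> L\<^sup>2\<close>, and \<open>F' \<ge> 0\<close> on \<open>[0,\<infinity>)\<close>. If \<open>u\<close>
  vanished somewhere, it would vanish exactly outside a ball, contradicting the principle for
  \<open>w = u\<close> at the boundary of that ball. If \<open>u\<close> equals a constant \<open>c\<close> on an annulus, then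
  \<open>F'(c) = \<mu>c\<close>, so \<open>c \<le> t\<^sub>0\<close>, and \<open>w = c - u\<close> is superharmonic outside the inner sphere; the
  principle at the outer boundary of the largest such annulus gives a contradiction. The
  nondecreasing case follows by passing to \<open>- u\<close>.
\<close>

section \<open>A smooth bump function\<close>

text \<open>For \<open>m = 0\<close> this is the classical function that is smooth but not analytic
  at 0. The powers of \<open>s\<close> in the denominator arise on differentiation; with them,
  derivatives of members of the family are linear combinations of members.\<close>

definition flat_exp :: "nat \<Rightarrow> real \<Rightarrow> real"
  where "flat_exp m s = (if s > 0 then exp (- 1 / s) / s ^ m else 0)"

lemma flat_exp_nonneg: "0 \<le> flat_exp m s"
  by (simp add: flat_exp_def)

lemma flat_exp_eq_0: "s \<le> 0 \<Longrightarrow> flat_exp m s = 0"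
  by (simp add: flat_exp_def)

text \<open>The term of index \<open>m + 2\<close> of the exponential series at \<open>1 / s\<close>
  gives \<open>exp (- 1 / s) \<le> fact (m + 2) * s ^ (m + 2)\<close>. Two powers of
  \<open>s\<close> survive division by \<open>s ^ m\<close>, enough for the derivative at 0 to
  vanish.\<close>

lemma flat_exp_le_square: "\<bar>flat_exp m s\<bar> \<le> fact (m + 2) * s\<^sup>2"
proof (cases "s > 0")
  case True
  have "(1 / s) ^ (m + 2) / fact (m + 2) \<le> exp (1 / s)"
  proof -
    have "(\<Sum>n\<in>{m + 2}. (1 / s) ^ n /\<^sub>R fact n) \<le> (\<Sum>n. (1 / s) ^ n /\<^sub>R fact n)"
      by (rule sum_le_suminf) (use True summable_exp_generic[of "1 / s"] in auto)
    then show ?thesis by (simp add: exp_def divide_inverse mult.commute)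
  qed
  then have "exp (- (1 / s)) \<le> fact (m + 2) * s ^ (m + 2)"
    using True by (simp add: exp_minus field_simps power_divide del: fact_Suc power_Suc add_2_eq_Suc')
  then show ?thesis
    using True
    by (simp add: flat_exp_def divide_le_eq power_add mult_ac del: fact_Suc power_Suc add_2_eq_Suc')
qed (simp add: flat_exp_def)

text \<open>For \<open>s > 0\<close> this is the quotient rule. At 0 the quadratic bound forces the
  difference quotient to 0, in agreement with the formula because every \<open>flat_exp\<close>
  vanishes there.\<close>

lemma flat_exp_has_derivative:
  "(flat_exp m has_real_derivative flat_exp (m + 2) s - real m * flat_exp (m + 1) s) (at s)"
proof -
  consider "s > 0" | "s < 0" | "s = 0" by linarith
  then show ?thesis
  proof cases
    case 1
    have "((\<lambda>s. exp (- 1 / s) / s ^ m) has_real_derivative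
        flat_exp (m + 2) s - real m * flat_exp (m + 1) s) (at s)"
      \<comment> \<open>Differentiating \<open>s ^ m\<close> yields the exponent
        \<open>m - 1\<close> in truncated subtraction, hence the separate case
        \<open>m = 0\<close>.\<close>
      using 1 power_minus_mult[of m s] by (cases "m = 0")
        (auto intro!: derivative_eq_intros simp: flat_exp_def field_simps power2_eq_square)
    then show ?thesis
      by (rule has_field_derivative_transform_within_open[where S = "{0<..}"])
        (use 1 in \<open>auto simp: flat_exp_def\<close>)
  next
    case 2
    have "((\<lambda>s. 0) has_real_derivative 0) (at s)" by simp
    then have "(flat_exp m has_real_derivative 0) (at s)"
      by (rule has_field_derivative_transform_within_open[where S = "{..<0}"])
        (use 2 in \<open>auto simp: flat_exp_def\<close>)
    then show ?thesis using 2 by (simp add: flat_exp_def)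
  next
    case 3
    have "((\<lambda>h. flat_exp m h / h) \<longlongrightarrow> 0) (at 0)"
    proof (rule Lim_null_comparison)
      show "\<forall>\<^sub>F h in at 0. norm (flat_exp m h / h) \<le> fact (m + 2) * \<bar>h\<bar>"
        unfolding eventually_at_filter
      proof (intro always_eventually allI impI)
        fix h :: real assume "h \<noteq> 0"
        then show "norm (flat_exp m h / h) \<le> fact (m + 2) * \<bar>h\<bar>"
          using flat_exp_le_square[of m h]
          by (simp add: abs_divide divide_le_eq power2_eq_square mult.assoc)
      qed
      show "((\<lambda>h::real. fact (m + 2) * \<bar>h\<bar>) \<longlongrightarrow> 0) (at 0)"
        by (auto intro!: tendsto_eq_intros)
    qed
    then show ?thesis using 3 by (simp add: DERIV_def flat_exp_def)
  qed
qed

text \<open>This algebra is closed under partial derivatives, so its members are smooth.\<close>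
inductive_set bump_algebra :: "real ^ 'n::finite \<Rightarrow> real \<Rightarrow> (real ^ 'n \<Rightarrow> real) set"
  for y :: "real ^ 'n" and c :: real
  where
    const: "(\<lambda>x. a) \<in> bump_algebra y c"
  | coord: "(\<lambda>x. (x - y) $ i) \<in> bump_algebra y c"
  | flat: "(\<lambda>x. flat_exp m (c - (norm (x - y))\<^sup>2)) \<in> bump_algebra y c"
  | add: "f \<in> bump_algebra y c \<Longrightarrow> g \<in> bump_algebra y c \<Longrightarrow> (\<lambda>x. f x + g x) \<in> bump_algebra y c"
  | mult: "f \<in> bump_algebra y c \<Longrightarrow> g \<in> bump_algebra y c \<Longrightarrow> (\<lambda>x. f x * g x) \<in> bump_algebra y c"

section \<open>Partial derivatives and smoothness of the algebra\<close>

lemma partial_derivI: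
  assumes "(f has_derivative D) (at x)" and "D (axis i 1) = d"
  shows "partial_deriv i f x = d"
  using assms frechet_derivative_at[OF assms(1)] by (simp add: partial_deriv_def)

lemma flat_exp_norm_has_derivative:
  fixes x y :: "'a::real_inner"
  shows "((\<lambda>x. flat_exp m (c - (norm (x - y))\<^sup>2)) has_derivative
    (\<lambda>h. (flat_exp (m + 2) (c - (norm (x - y))\<^sup>2) - real m * flat_exp (m + 1) (c - (norm (x - y))\<^sup>2))
      * (- 2 * ((x - y) \<bullet> h)))) (at x)"
proof -
  have "((\<lambda>x. c - (norm (x - y))\<^sup>2) has_derivative (\<lambda>h. - 2 * ((x - y) \<bullet> h))) (at x)"
    unfolding power2_norm_eq_inner
    by (auto intro!: derivative_eq_intros simp: inner_commute algebra_simps)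
  from has_derivative_compose[OF this flat_exp_has_derivative[unfolded has_field_derivative_def]]
  show ?thesis by (simp add: mult_ac)
qed

lemma partial_deriv_flat_exp_norm:
  "partial_deriv i (\<lambda>x. flat_exp m (c - (norm (x - y))\<^sup>2)) x =
    (flat_exp (m + 2) (c - (norm (x - y))\<^sup>2) - real m * flat_exp (m + 1) (c - (norm (x - y))\<^sup>2))
      * (- 2 * (x - y) $ i)"
  by (rule partial_derivI[OF flat_exp_norm_has_derivative]) (simp add: inner_axis)

lemma partial_deriv_mult:
  assumes "f differentiable (at x)" "g differentiable (at x)"
  shows "partial_deriv i (\<lambda>x. f x * g x) x = f x * partial_deriv i g x + partial_deriv i f x * g x"
  unfolding partial_deriv_def
  by (rule partial_derivI[unfolded partial_deriv_def, OF has_derivative_mult])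
    (use assms in \<open>auto simp: frechet_derivative_works\<close>)

lemma partial_deriv_add:
  assumes "f differentiable (at x)" "g differentiable (at x)"
  shows "partial_deriv i (\<lambda>x. f x + g x) x = partial_deriv i f x + partial_deriv i g x"
  unfolding partial_deriv_def
  by (rule partial_derivI[unfolded partial_deriv_def, OF has_derivative_add])
    (use assms in \<open>auto simp: frechet_derivative_works\<close>)

lemma partial_deriv_coord: "partial_deriv i (\<lambda>x. (x - y) $ j) x = (if i = j then 1 else 0)"
proof (rule partial_derivI)
  show "((\<lambda>x. (x - y) $ j) has_derivative (\<lambda>h. h $ j)) (at x)"
    by (auto intro!: derivative_eq_intros bounded_linear.has_derivative[OF bounded_linear_vec_nth])
qed (simp add: axis_def)

lemma partial_deriv_const: "partial_deriv i (\<lambda>x. a) x = 0"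
  by (rule partial_derivI[OF has_derivative_const]) simp

lemma bump_algebra_differentiable:
  "f \<in> bump_algebra y c \<Longrightarrow> f differentiable (at x)"
proof (induction rule: bump_algebra.induct)
  case (coord i)
  show ?case
    unfolding differentiable_def
    by (auto intro!: exI derivative_eq_intros bounded_linear.has_derivative[OF bounded_linear_vec_nth])
next
  case (flat m)
  show ?case using flat_exp_norm_has_derivative differentiableI by blast
qed auto

lemma partial_deriv_bump_algebra:
  "f \<in> bump_algebra y c \<Longrightarrow> partial_deriv i f \<in> bump_algebra y c"
proof (induction rule: bump_algebra.induct)
  case (const a)
  show ?case using bump_algebra.const[of 0] by (simp add: partial_deriv_const[abs_def])
next
  case (coord j)
  show ?case 
    by (auto simp: partial_deriv_coord[abs_def] simp del: vector_minus_component intro: bump_algebra.const)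
next
  case (flat m)
  have *: "partial_deriv i (\<lambda>x. flat_exp m (c - (norm (x - y))\<^sup>2)) =
    (\<lambda>x. (flat_exp (m + 2) (c - (norm (x - y))\<^sup>2) + (- real m) * flat_exp (m + 1) (c - (norm (x - y))\<^sup>2))
      * ((- 2) * (x - y) $ i))"
    by (rule ext) (simp add: partial_deriv_flat_exp_norm)
  show ?case unfolding * by (intro bump_algebra.intros)
next
  case (add f g)
  then have "partial_deriv i (\<lambda>x. f x + g x) = (\<lambda>x. partial_deriv i f x + partial_deriv i g x)"
    by (intro ext partial_deriv_add bump_algebra_differentiable)
  then show ?case using add by (simp add: bump_algebra.add)
next
  case (mult f g)
  then have "partial_deriv i (\<lambda>x. f x * g x) =
      (\<lambda>x. f x * partial_deriv i g x + partial_deriv i f x * g x)"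
    by (intro ext partial_deriv_mult bump_algebra_differentiable)
  then show ?case using mult by (simp add: bump_algebra.add bump_algebra.mult)
qed

lemma bump_algebra_Ck: "f \<in> bump_algebra y c \<Longrightarrow> Ck k f"
  by (induction k arbitrary: f)
    (auto intro: partial_deriv_bump_algebra bump_algebra_differentiable
      differentiable_imp_continuous_within simp: continuous_on_eq_continuous_within)

text \<open>The parameter \<open>c\<close> is the square of the radius, so that the bump is a
  function of |x - y|^2 and stays differentiable at the centre.\<close>

definition bump :: "real ^ 'n::finite \<Rightarrow> real \<Rightarrow> real ^ 'n \<Rightarrow> real"
  where "bump y c x = flat_exp 0 (c - (norm (x - y))\<^sup>2)"

lemma bump_nonneg: "0 \<le> bump y c x"
  by (simp add: bump_def flat_exp_nonneg)

lemma bump_eq_0: "0 \<le> \<rho> \<Longrightarrow> \<rho> \<le> norm (x - y) \<Longrightarrow> bump y (\<rho>\<^sup>2) x = 0"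
  by (simp add: bump_def flat_exp_eq_0 power_mono del: power_mono_iff)

lemma bump_test_function: "bump y c \<in> test_functions"
proof -
  \<comment> \<open>The absolute value covers negative \<open>c\<close>, for which the bump is
    identically 0.\<close>
  have "{x. bump y c x \<noteq> 0} \<subseteq> cball y (sqrt \<bar>c\<bar>)"
  proof
    fix x assume "x \<in> {x. bump y c x \<noteq> 0}"
    then have "(norm (x - y))\<^sup>2 \<le> \<bar>c\<bar>"
      by (auto simp: bump_def flat_exp_def split: if_splits)
    then have "norm (x - y) \<le> sqrt \<bar>c\<bar>"
      by (rule real_le_rsqrt)
    then show "x \<in> cball y (sqrt \<bar>c\<bar>)"
      by (simp add: dist_norm norm_minus_commute)
  qed
  then have "compact (closure {x. bump y c x \<noteq> 0})"
    using bounded_cball bounded_subset compact_closure by blast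
  moreover have "Ck k (bump y c)" for k
    using bump_algebra_Ck[OF bump_algebra.flat] by (simp add: bump_def[abs_def])
  ultimately show ?thesis by (simp add: test_functions_def)
qed

section \<open>The Laplacian of the bump function\<close>

definition laplacian :: "(real ^ 'n::finite \<Rightarrow> real) \<Rightarrow> real ^ 'n \<Rightarrow> real"
  where "laplacian f x = (\<Sum>i\<in>UNIV. partial_deriv i (partial_deriv i f) x)"

text \<open>The bump is h(s) with h = \<open>flat_exp 0\<close> and s = c - |x - y|^2, so its
  Laplacian is 4 |x - y|^2 h''(s) - 2 N h'(s). Here h' is \<open>flat_exp 2\<close>, and h'' is
  \<open>flat_exp 4\<close> minus twice \<open>flat_exp 3\<close>.\<close>

lemma laplacian_bump:
  fixes y :: "real ^ 'n::finite"
  shows "laplacian (bump y c) x =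
    4 * (norm (x - y))\<^sup>2 * (flat_exp 4 (c - (norm (x - y))\<^sup>2) - 2 * flat_exp 3 (c - (norm (x - y))\<^sup>2))
    - 2 * real CARD('n) * flat_exp 2 (c - (norm (x - y))\<^sup>2)"
proof -
  let ?q = "\<lambda>x. c - (norm (x - y))\<^sup>2"
  have 1: "partial_deriv i (bump y c) = (\<lambda>x. flat_exp 2 (?q x) * (- 2 * (x - y) $ i))" for i
    using partial_deriv_flat_exp_norm[of i 0 c y]
    by (simp add: fun_eq_iff bump_def[abs_def] numeral_2_eq_2)
  have "partial_deriv i (partial_deriv i (bump y c)) x =
      4 * ((x - y) $ i)\<^sup>2 * (flat_exp 4 (?q x) - 2 * flat_exp 3 (?q x)) - 2 * flat_exp 2 (?q x)" for i
  proof -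
    have a: "(\<lambda>x. flat_exp 2 (?q x)) \<in> bump_algebra y c"
      by (rule bump_algebra.flat)
    have b: "(\<lambda>x. (- 2) * (x - y) $ i) \<in> bump_algebra y c"
      by (intro bump_algebra.intros)
    have "partial_deriv i (\<lambda>x. (- 2) * (x - y) $ i) x = - 2"
      by (subst partial_deriv_mult)
        (auto intro: bump_algebra_differentiable bump_algebra.intros
          simp: partial_deriv_const partial_deriv_coord simp del: vector_minus_component)
    then show ?thesis
      unfolding 1
      apply (subst partial_deriv_mult[OF a[THEN bump_algebra_differentiable] b[THEN bump_algebra_differentiable]])
      apply (subst partial_deriv_flat_exp_norm)
      by (simp add: power2_eq_square algebra_simps eval_nat_numeral)
  qed
  then have "laplacian (bump y c) x = (\<Sum>i\<in>UNIV. 4 * ((x - y) $ i)\<^sup>2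
      * (flat_exp 4 (?q x) - 2 * flat_exp 3 (?q x)) - 2 * flat_exp 2 (?q x))"
    by (simp add: laplacian_def)
  also have "\<dots> = 4 * (\<Sum>i\<in>UNIV. ((x - y) $ i)\<^sup>2) * (flat_exp 4 (?q x) - 2 * flat_exp 3 (?q x))
      - 2 * real CARD('n) * flat_exp 2 (?q x)"
    by (simp add: sum_subtractf sum_distrib_left sum_distrib_right)
  also have "(\<Sum>i\<in>UNIV. ((x - y) $ i)\<^sup>2) = (norm (x - y))\<^sup>2"
    by (simp add: norm_vec_def L2_set_def sum_nonneg)
  finally show ?thesis .
qed

lemma laplacian_bump_eq_0: "0 \<le> \<rho> \<Longrightarrow> \<rho> \<le> norm (x - y) \<Longrightarrow> laplacian (bump y (\<rho>\<^sup>2)) x = 0"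
  by (simp add: laplacian_bump flat_exp_eq_0 power_mono del: power_mono_iff)

text \<open>After the factor exp(-1/s) / s^4 is taken out, the difference of the two sides is 4 |x -
  y|^2 (1 - 2 s) - 2 N s^2 - \<mu> s^4. The first term is at least 2 \<delta>^2 because s \<le> 1/4,
  and the other two are together at most \<epsilon> (2 N + \<mu>).\<close>

lemma bump_subsolution:
  fixes y x :: "real ^ 'n::finite"
  assumes "0 < \<delta>" "0 < \<epsilon>" "\<epsilon> \<le> 1 / 4" "\<epsilon> * (2 * real CARD('n) + \<mu>) < 2 * \<delta>\<^sup>2" "0 \<le> \<mu>"
    and "\<delta> \<le> norm (x - y)" "(norm (x - y))\<^sup>2 < \<delta>\<^sup>2 + \<epsilon>"
  shows "\<mu> * bump y (\<delta>\<^sup>2 + \<epsilon>) x < laplacian (bump y (\<delta>\<^sup>2 + \<epsilon>)) x"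
proof -
  define s where "s = \<delta>\<^sup>2 + \<epsilon> - (norm (x - y))\<^sup>2"
  have d: "\<delta>\<^sup>2 \<le> (norm (x - y))\<^sup>2" using assms by (intro power_mono) auto
  then have s: "0 < s" "s \<le> \<epsilon>" using assms by (auto simp: s_def)
  have "s\<^sup>2 \<le> \<epsilon>" "s ^ 4 \<le> \<epsilon>"
  proof -
    have "s ^ 2 \<le> s ^ 1" "s ^ 4 \<le> s ^ 1"
      using s assms by (intro power_decreasing; simp)+
    then show "s\<^sup>2 \<le> \<epsilon>" "s ^ 4 \<le> \<epsilon>" using s by auto
  qed
  then have "2 * real CARD('n) * s\<^sup>2 + \<mu> * s ^ 4 \<le> 2 * real CARD('n) * \<epsilon> + \<mu> * \<epsilon>"
    using assms by (intro add_mono mult_left_mono) auto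
  also have "\<dots> < 2 * \<delta>\<^sup>2" using assms by (simp add: algebra_simps)
  also have "\<dots> \<le> 4 * \<delta>\<^sup>2 * (1 - 2 * s)"
    using mult_left_mono[of "1 / 2" "1 - 2 * s" "4 * \<delta>\<^sup>2"] s assms by simp
  also have "\<dots> \<le> 4 * (norm (x - y))\<^sup>2 * (1 - 2 * s)"
    using d s assms by (intro mult_right_mono) auto
  finally have *: "0 < 4 * (norm (x - y))\<^sup>2 * (1 - 2 * s) - 2 * real CARD('n) * s\<^sup>2 - \<mu> * s ^ 4"
    by simp
  have "laplacian (bump y (\<delta>\<^sup>2 + \<epsilon>)) x - \<mu> * bump y (\<delta>\<^sup>2 + \<epsilon>) x =
     exp (- 1 / s) / s ^ 4 * (4 * (norm (x - y))\<^sup>2 * (1 - 2 * s) - 2 * real CARD('n) * s\<^sup>2 - \<mu> * s ^ 4)"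
    unfolding laplacian_bump bump_def s_def[symmetric] using s(1)
    by (simp add: flat_exp_def field_simps eval_nat_numeral)
  then show ?thesis using * s(1) by (smt (verit) divide_pos_pos exp_gt_zero mult_pos_pos zero_less_power)
qed

section \<open>Test functions\<close>

text \<open>Differentiation is local, so the support does not grow.\<close>

lemma partial_deriv_test_function:
  assumes "\<psi> \<in> test_functions"
  shows "partial_deriv i \<psi> \<in> test_functions"
proof -
  have Ck: "\<And>k. Ck k \<psi>" and supp: "compact (closure {x. \<psi> x \<noteq> 0})"
    using assms by (auto simp: test_functions_def)
  have "partial_deriv i \<psi> x = 0" if "x \<notin> closure {x. \<psi> x \<noteq> 0}" for x
  proof (rule partial_derivI)
    have "((\<lambda>x. 0) has_derivative (\<lambda>h. 0)) (at x)" by simp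
    then show "(\<psi> has_derivative (\<lambda>h. 0)) (at x)"
      by (rule has_derivative_transform_within_open[of _ _ _ UNIV "- closure {x. \<psi> x \<noteq> 0}"])
        (use that closure_subset[of "{x. \<psi> x \<noteq> 0}"] in \<open>auto simp: open_Compl\<close>)
  qed simp
  then have "{x. partial_deriv i \<psi> x \<noteq> 0} \<subseteq> closure {x. \<psi> x \<noteq> 0}" by auto
  then have "compact (closure {x. partial_deriv i \<psi> x \<noteq> 0})"
    using supp by (metis bounded_closure bounded_subset compact_closure compact_imp_bounded)
  moreover have "Ck k (partial_deriv i \<psi>)" for k
    using Ck[of "Suc k"] by simp
  ultimately show ?thesis by (simp add: test_functions_def)
qed

lemma test_function_continuous: "\<psi> \<in> test_functions \<Longrightarrow> continuous_on UNIV \<psi>"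
  using Ck.simps(1) by (fastforce simp: test_functions_def)

lemma test_function_differentiable: "\<psi> \<in> test_functions \<Longrightarrow> \<psi> differentiable (at x)"
  using Ck.simps(2)[of 0 \<psi>] by (fastforce simp: test_functions_def)

lemma test_function_measurable: "\<psi> \<in> test_functions \<Longrightarrow> \<psi> \<in> borel_measurable borel"
  by (intro borel_measurable_continuous_onI test_function_continuous)

text \<open>The condition \<open>h 0 = 0\<close> keeps the composition supported in the compact
  support of \<open>\<psi>\<close>. The cases of interest are the identity and the square.\<close>

lemma test_function_integrable_comp:
  fixes h :: "real \<Rightarrow> real"
  assumes "\<psi> \<in> test_functions" "continuous_on UNIV h" "h 0 = 0"
  shows "integrable lborel (\<lambda>x. h (\<psi> x))"
proof -
  let ?K = "closure {x. \<psi> x \<noteq> 0}"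
  have "continuous_on ?K (\<lambda>x. h (\<psi> x))"
    using continuous_on_compose2[OF assms(2) test_function_continuous[OF assms(1)]]
    by (auto intro: continuous_on_subset)
  then have "integrable lborel (\<lambda>x. indicator ?K x *\<^sub>R h (\<psi> x))"
    using assms by (intro borel_integrable_compact) (auto simp: test_functions_def)
  also have "(\<lambda>x. indicator ?K x *\<^sub>R h (\<psi> x)) = (\<lambda>x. h (\<psi> x))"
    using closure_subset[of "{x. \<psi> x \<noteq> 0}"] assms(3)
    by (force simp: indicator_def fun_eq_iff subset_iff)
  finally show ?thesis .
qed

section \<open>Integrals against test functions\<close>

lemma test_function_integrable: "\<psi> \<in> test_functions \<Longrightarrow> integrable lborel \<psi>"
  using test_function_integrable_comp[of \<psi> "\<lambda>t. t"] by simp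

lemma Lp_space_two_iff:
  "f \<in> Lp_space 2 \<longleftrightarrow> f \<in> borel_measurable lborel \<and> integrable lborel (\<lambda>x. (norm (f x))\<^sup>2)"
  by (simp add: Lp_space_def powr_numeral)

lemma integrable_L2_mult_test:
  assumes "f \<in> Lp_space 2" "\<psi> \<in> test_functions"
  shows "integrable lborel (\<lambda>x. f x * \<psi> x)"
proof (rule Bochner_Integration.integrable_bound)
  show "integrable lborel (\<lambda>x. (norm (f x))\<^sup>2 + (\<psi> x)\<^sup>2)"
    using assms(1) test_function_integrable_comp[OF assms(2), of "\<lambda>t. t\<^sup>2"]
      continuous_on_power[OF continuous_on_id, of "UNIV :: real set" 2]
    by (simp add: Lp_space_two_iff)
  show "(\<lambda>x. f x * \<psi> x) \<in> borel_measurable lborel"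
    using assms test_function_measurable[OF assms(2)] by (auto simp: Lp_space_two_iff)
  have "\<bar>f x * \<psi> x\<bar> \<le> (f x)\<^sup>2 + (\<psi> x)\<^sup>2" for x
  proof -
    have "2 * \<bar>f x * \<psi> x\<bar> \<le> (f x)\<^sup>2 + (\<psi> x)\<^sup>2"
      using sum_squares_bound[of "\<bar>f x\<bar>" "\<bar>\<psi> x\<bar>"] by (simp add: abs_mult)
    then show ?thesis using abs_ge_zero[of "f x * \<psi> x"] by linarith
  qed
  then show "AE x in lborel. norm (f x * \<psi> x) \<le> norm ((norm (f x))\<^sup>2 + (\<psi> x)\<^sup>2)"
    by simp
qed

lemma Lp_space_two_component:
  fixes G :: "real ^ 'n::finite \<Rightarrow> real ^ 'n"
  assumes "G \<in> Lp_space 2"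
  shows "(\<lambda>x. G x $ i) \<in> Lp_space 2"
proof -
  have m: "(\<lambda>x. G x $ i) \<in> borel_measurable borel"
    using assms borel_measurable_continuous_onI[of "\<lambda>v::real ^ 'n. v $ i"]
    by (auto simp: Lp_space_two_iff intro: measurable_compose continuous_on_component)
  have "integrable lborel (\<lambda>x. (norm (G x $ i))\<^sup>2)"
  proof (rule Bochner_Integration.integrable_bound)
    show "integrable lborel (\<lambda>x. (norm (G x))\<^sup>2)"
      using assms by (simp add: Lp_space_two_iff)
    show "AE x in lborel. norm ((norm (G x $ i))\<^sup>2) \<le> norm ((norm (G x))\<^sup>2)"
      using power_mono[OF component_le_norm_cart abs_ge_zero, of "G _" i 2] by simp
  qed (use m in auto)
  with m show ?thesis by (simp add: Lp_space_two_iff)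
qed

text \<open>The partial derivative is the limit of difference quotients, whose integrals vanish by
  translation invariance of Lebesgue measure; dominated convergence carries this to the
  limit.\<close>

lemma integral_partial_deriv_test:
  fixes \<psi> :: "real ^ 'n::finite \<Rightarrow> real"
  assumes "\<psi> \<in> test_functions"
  shows "(\<integral>x. partial_deriv i \<psi> x \<partial>lborel) = 0"
proof -
  let ?e = "axis i 1 :: real ^ 'n"
  \<comment> \<open>The increments 1/(n + 1) are nonzero and at most 1, so one enlarged ball serves
    all \<open>n\<close>.\<close>
  let ?h = "\<lambda>n::nat. inverse (real (Suc n))"
  let ?D = "\<lambda>n x. (\<psi> (x + ?h n *\<^sub>R ?e) - \<psi> x) / ?h n"
  let ?K = "closure {x. \<psi> x \<noteq> 0}"
  have cont: "continuous_on UNIV (partial_deriv i \<psi>)"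
    by (intro test_function_continuous partial_deriv_test_function assms)
  have der: "((\<lambda>t. \<psi> (x + t *\<^sub>R ?e)) has_real_derivative partial_deriv i \<psi> (x + t *\<^sub>R ?e)) (at t)" for x t
  proof -
    have "(\<psi> has_derivative frechet_derivative \<psi> (at (x + t *\<^sub>R ?e))) (at (x + t *\<^sub>R ?e))"
      using test_function_differentiable[OF assms] frechet_derivative_works by blast
    moreover have "((\<lambda>t. x + t *\<^sub>R ?e) has_derivative (\<lambda>h. h *\<^sub>R ?e)) (at t)"
      by (auto intro!: derivative_eq_intros)
    ultimately have "((\<lambda>t. \<psi> (x + t *\<^sub>R ?e)) has_derivative
        (\<lambda>h. frechet_derivative \<psi> (at (x + t *\<^sub>R ?e)) (h *\<^sub>R ?e))) (at t)"
      by (rule has_derivative_compose[rotated])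
    moreover have "linear (frechet_derivative \<psi> (at (x + t *\<^sub>R ?e)))"
      using test_function_differentiable[OF assms] linear_frechet_derivative by blast
    ultimately show ?thesis
      by (simp add: has_field_derivative_def partial_deriv_def linear_cmul mult.commute[of _ "frechet_derivative _ _ _"])
  qed
  obtain M where M: "\<And>x. \<bar>partial_deriv i \<psi> x\<bar> \<le> M" and "0 \<le> M"
  proof -
    let ?K' = "closure {x. partial_deriv i \<psi> x \<noteq> 0}"
    have "compact ?K'"
      using partial_deriv_test_function[OF assms] by (simp add: test_functions_def)
    then have "bounded (partial_deriv i \<psi> ` ?K')"
      by (intro compact_imp_bounded compact_continuous_image continuous_on_subset[OF cont subset_UNIV])
    then obtain M where "\<And>x. x \<in> ?K' \<Longrightarrow> \<bar>partial_deriv i \<psi> x\<bar> \<le> M"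
      by (auto simp: bounded_iff)
    then have "\<bar>partial_deriv i \<psi> x\<bar> \<le> max M 0" for x
      using subsetD[OF closure_subset, of x "{x. partial_deriv i \<psi> x \<noteq> 0}"]
      by (cases "partial_deriv i \<psi> x = 0") (auto simp: le_max_iff_disj)
    then show thesis by (intro that[of "max M 0"]) simp_all
  qed
  have "compact ?K" using assms by (simp add: test_functions_def)
  then obtain B where B: "\<And>x. x \<in> ?K \<Longrightarrow> norm x \<le> B"
    using compact_imp_bounded[of ?K] unfolding bounded_iff by blast
  \<comment> \<open>Inside the ball the mean value theorem replaces the quotient by a value of the
    derivative. Outside it neither \<open>x\<close> nor the shifted point, at distance at most 1,
    meets the support.\<close>
  have bound: "\<bar>?D n x\<bar> \<le> M * indicator (cball 0 (B + 1)) x" for n x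
  proof (cases "x \<in> cball 0 (B + 1)")
    case True
    have "\<exists>z. z > 0 \<and> z < ?h n \<and> \<psi> (x + ?h n *\<^sub>R ?e) - \<psi> (x + 0 *\<^sub>R ?e)
        = (?h n - 0) * partial_deriv i \<psi> (x + z *\<^sub>R ?e)"
      by (rule MVT2) (use der in auto)
    then have "\<exists>z. ?D n x = partial_deriv i \<psi> (x + z *\<^sub>R ?e)"
      by (auto simp del: of_nat_Suc)
    then show ?thesis using True M by (metis indicator_simps(1) mult.right_neutral)
  next
    case False
    then have "norm x > B + 1" by simp
    moreover have "norm x \<le> norm (x + ?h n *\<^sub>R ?e) + ?h n"
      using norm_triangle_ineq4[of "x + ?h n *\<^sub>R ?e" "?h n *\<^sub>R ?e"] by (simp add: norm_axis_1)
    moreover have "?h n \<le> 1" by (simp add: inverse_le_1_iff)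
    ultimately have "norm x > B" "norm (x + ?h n *\<^sub>R ?e) > B" by linarith+
    then have "\<psi> x = 0" "\<psi> (x + ?h n *\<^sub>R ?e) = 0"
      using B subsetD[OF closure_subset, of _ "{x. \<psi> x \<noteq> 0}"] by (meson mem_Collect_eq not_le)+
    then show ?thesis using False by simp
  qed
  have "(\<lambda>n. integral\<^sup>L lborel (?D n)) \<longlonglongrightarrow> (\<integral>x. partial_deriv i \<psi> x \<partial>lborel)"
  proof (rule integral_dominated_convergence)
    have mpsi: "\<psi> \<in> borel_measurable borel"
      by (rule test_function_measurable[OF assms])
    show "partial_deriv i \<psi> \<in> borel_measurable lborel"
      using cont by (simp add: borel_measurable_continuous_onI)
    show "?D n \<in> borel_measurable lborel" for n
      using mpsi by simp
    show "integrable lborel (\<lambda>x. M * indicator (cball 0 (B + 1)) x :: real)"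
      by (intro integrable_mult_right integrable_real_indicator emeasure_bounded_finite) auto
    show "AE x in lborel. norm (?D n x) \<le> M * indicator (cball 0 (B + 1)) x" for n
      using bound by simp
    have "(\<lambda>n. ?D n x) \<longlonglongrightarrow> partial_deriv i \<psi> x" for x
    proof -
      have "((\<lambda>h. (\<psi> (x + h *\<^sub>R ?e) - \<psi> x) / h) \<longlongrightarrow> partial_deriv i \<psi> x) (at 0)"
        using der[of x 0] by (simp add: DERIV_def)
      moreover have "filterlim ?h (at 0) sequentially"
        using LIMSEQ_inverse_real_of_nat by (auto simp: filterlim_at simp del: of_nat_Suc)
      ultimately show ?thesis by (rule filterlim_compose)
    qed
    then show "AE x in lborel. (\<lambda>n. ?D n x) \<longlonglongrightarrow> partial_deriv i \<psi> x" by simp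
  qed
  moreover have "integral\<^sup>L lborel (?D n) = 0" for n
  proof -
    have i: "integrable lborel \<psi>" by (rule test_function_integrable[OF assms])
    have m: "\<psi> \<in> borel_measurable borel" by (rule test_function_measurable[OF assms])
    have "integrable (distr lborel borel ((+) (?h n *\<^sub>R ?e))) \<psi>"
      using i by (simp only: lborel_distr_plus)
    then have "integrable lborel (\<lambda>x. \<psi> (?h n *\<^sub>R ?e + x))"
      by (subst (asm) integrable_distr_eq) (use m in auto)
    moreover have "(\<integral>x. \<psi> (?h n *\<^sub>R ?e + x) \<partial>lborel) = (\<integral>x. \<psi> x \<partial>lborel)"
      using integral_distr[of "(+) (?h n *\<^sub>R ?e)" lborel borel \<psi>] m by (simp add: lborel_distr_plus)
    ultimately show ?thesis using i by (simp add: add.commute)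
  qed
  ultimately show ?thesis by (simp add: LIMSEQ_const_iff)
qed

text \<open>Constants are harmonic in the distributional sense. This is what allows a solution
  \<open>u\<close> to be replaced by \<open>c - u\<close>, although constants are not square
  integrable.\<close>

lemma integral_laplacian_test:
  assumes "\<psi> \<in> test_functions"
  shows "(\<integral>x. laplacian \<psi> x \<partial>lborel) = 0"
proof -
  have "partial_deriv i \<psi> \<in> test_functions" for i
    by (rule partial_deriv_test_function[OF assms])
  then show ?thesis
    unfolding laplacian_def
    by (simp add: integral_partial_deriv_test test_function_integrable partial_deriv_test_function)
qed

lemma integrable_laplacian_test:
  assumes "\<psi> \<in> test_functions"
  shows "integrable lborel (laplacian \<psi>)"
  unfolding laplacian_def[abs_def]
  by (intro Bochner_Integration.integrable_sum test_function_integrable partial_deriv_test_function assms)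

lemma integrable_L2_mult_laplacian:
  assumes "f \<in> Lp_space 2" "\<psi> \<in> test_functions"
  shows "integrable lborel (\<lambda>x. f x * laplacian \<psi> x)"
  unfolding laplacian_def sum_distrib_left
  by (intro Bochner_Integration.integrable_sum integrable_L2_mult_test partial_deriv_test_function assms)

section \<open>Distributional solutions and the strong maximum principle\<close>

text \<open>All derivatives fall on the test function, so the weak gradient, which is fixed only by
  a choice, no longer appears. The sign convention is \<Delta>u = \<mu> u - f(u).\<close>

definition distributional_solution :: "real \<Rightarrow> (real \<Rightarrow> real) \<Rightarrow> (real ^ 'n::finite \<Rightarrow> real) \<Rightarrow> bool"
  where "distributional_solution \<mu> f u \<longleftrightarrow>
    (\<forall>\<psi>\<in>test_functions.
      integrable lborel (\<lambda>x. f (u x) * \<psi> x) \<and>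
      (\<integral>x. u x * laplacian \<psi> x \<partial>lborel) = (\<integral>x. \<mu> * u x * \<psi> x - f (u x) * \<psi> x \<partial>lborel))"

text \<open>Each partial derivative of \<open>\<psi>\<close> is again a test function, so the
  definition of the weak gradient applies to it and moves the remaining derivative off
  \<open>u\<close>.\<close>

lemma weak_solution_imp_distributional:
  fixes u :: "real ^ 'n::finite \<Rightarrow> real"
  assumes "weak_solution \<mu> f u"
  shows "distributional_solution \<mu> f u"
  unfolding distributional_solution_def
proof
  fix \<psi> :: "real ^ 'n \<Rightarrow> real"
  assume psi: "\<psi> \<in> test_functions"
  have f: "integrable lborel (\<lambda>x. f (u x) * \<psi> x)"
    and eq: "(\<integral>x. weak_gradient u x \<bullet> gradient \<psi> x + \<mu> * u x * \<psi> x \<partial>lborel) = (\<integral>x. f (u x) * \<psi> x \<partial>lborel)"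
    using assms psi by (auto simp: weak_solution_def)
  have u: "u \<in> Lp_space 2" and "\<exists>G. G \<in> Lp_space 2 \<and> is_weak_gradient u G"
    using assms by (auto simp: weak_solution_def H1_def)
  from someI_ex[OF this(2)]
  have G: "weak_gradient u \<in> Lp_space 2" "is_weak_gradient u (weak_gradient u)"
    by (auto simp: weak_gradient_def)
  have dpsi: "partial_deriv i \<psi> \<in> test_functions" for i
    by (rule partial_deriv_test_function[OF psi])
  have iG: "integrable lborel (\<lambda>x. weak_gradient u x $ i * partial_deriv i \<psi> x)" for i
    by (intro integrable_L2_mult_test Lp_space_two_component G dpsi)
  have iu: "integrable lborel (\<lambda>x. \<mu> * u x * \<psi> x)"
    using integrable_mult_right[OF integrable_L2_mult_test[OF u psi], of \<mu>] by (simp add: mult.assoc)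
  have "(\<integral>x. u x * laplacian \<psi> x \<partial>lborel) =
      (\<Sum>i\<in>UNIV. \<integral>x. u x * partial_deriv i (partial_deriv i \<psi>) x \<partial>lborel)"
    unfolding laplacian_def sum_distrib_left
    by (intro Bochner_Integration.integral_sum integrable_L2_mult_test[OF u] partial_deriv_test_function psi)
  also have "\<dots> = (\<Sum>i\<in>UNIV. - (\<integral>x. weak_gradient u x $ i * partial_deriv i \<psi> x \<partial>lborel))"
    using G(2) dpsi unfolding is_weak_gradient_def by (intro sum.cong) blast+
  also have "\<dots> = - (\<integral>x. weak_gradient u x \<bullet> gradient \<psi> x \<partial>lborel)"
    using iG by (simp add: inner_vec_def gradient_def sum_negf)
  also have "\<dots> = (\<integral>x. \<mu> * u x * \<psi> x \<partial>lborel) - (\<integral>x. f (u x) * \<psi> x \<partial>lborel)"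
  proof -
    have "integrable lborel (\<lambda>x. weak_gradient u x \<bullet> gradient \<psi> x)"
      unfolding inner_vec_def gradient_def using iG by simp
    then show ?thesis using eq iu by simp
  qed
  finally show "integrable lborel (\<lambda>x. f (u x) * \<psi> x) \<and>
      (\<integral>x. u x * laplacian \<psi> x \<partial>lborel) = (\<integral>x. \<mu> * u x * \<psi> x - f (u x) * \<psi> x \<partial>lborel)"
    using f iu by simp
qed

lemma distributional_solution_uminus:
  assumes "distributional_solution \<mu> f u"
  shows "distributional_solution \<mu> (\<lambda>t. - f (- t)) (\<lambda>x. - u x)"
  unfolding distributional_solution_def
proof (intro ballI conjI)
  fix \<psi> :: "real ^ 'a \<Rightarrow> real" assume "\<psi> \<in> test_functions"
  then have f: "integrable lborel (\<lambda>x. f (u x) * \<psi> x)"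
    and eq: "(\<integral>x. u x * laplacian \<psi> x \<partial>lborel) = (\<integral>x. \<mu> * u x * \<psi> x - f (u x) * \<psi> x \<partial>lborel)"
    using assms by (auto simp: distributional_solution_def)
  show "integrable lborel (\<lambda>x. - f (- (- u x)) * \<psi> x)" using f by simp
  have "(\<lambda>x. \<mu> * - u x * \<psi> x - - f (- (- u x)) * \<psi> x) = (\<lambda>x. - (\<mu> * u x * \<psi> x - f (u x) * \<psi> x))"
    by auto
  then show "(\<integral>x. - u x * laplacian \<psi> x \<partial>lborel) =
      (\<integral>x. \<mu> * - u x * \<psi> x - - f (- (- u x)) * \<psi> x \<partial>lborel)"
    using eq by (simp only: mult_minus_left Bochner_Integration.integral_minus)
qed

text \<open>The supersolution property is tested with a single bump. Its integrability clauses
  exclude integrals that are 0 by default, and vanishing is obtained almost everywhere because it is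
  read off from an integral.\<close>

lemma strong_maximum_principle:
  fixes w :: "real ^ 'n::finite \<Rightarrow> real"
  assumes "0 < \<delta>" "\<delta> < r" "0 \<le> \<mu>"
    and nonneg: "\<And>x. x \<in> ball y r \<Longrightarrow> 0 \<le> w x"
    and zero: "\<And>x. x \<in> ball y \<delta> \<Longrightarrow> w x = 0"
    and meas: "w \<in> borel_measurable borel"
    and super: "\<And>\<psi>. \<psi> \<in> test_functions \<Longrightarrow> (\<And>x. 0 \<le> \<psi> x) \<Longrightarrow> (\<And>x. x \<notin> ball y r \<Longrightarrow> \<psi> x = 0) \<Longrightarrow>
      integrable lborel (\<lambda>x. w x * laplacian \<psi> x) \<and> integrable lborel (\<lambda>x. w x * \<psi> x) \<and>
      (\<integral>x. w x * laplacian \<psi> x \<partial>lborel) \<le> \<mu> * (\<integral>x. w x * \<psi> x \<partial>lborel)"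
  obtains \<rho> where "\<delta> < \<rho>" "\<rho> \<le> r" "AE x in lborel. x \<in> ball y \<rho> \<longrightarrow> w x = 0"
proof -
  let ?k = "2 * real CARD('n) + \<mu> + 1"
  \<comment> \<open>The first two bounds are those of \<open>bump_subsolution\<close>, as
    \<open>?k\<close> exceeds 2 N + \<mu>; the third keeps the enlarged radius \<open>\<rho>\<close>
    at most \<open>r\<close>.\<close>
  define \<epsilon> where "\<epsilon> = min (min (1 / 4) (\<delta>\<^sup>2 / ?k)) (r\<^sup>2 - \<delta>\<^sup>2)"
  define \<rho> where "\<rho> = sqrt (\<delta>\<^sup>2 + \<epsilon>)"
  have k: "0 < ?k" using assms by (simp add: add_nonneg_pos)
  have "\<delta>\<^sup>2 < r\<^sup>2" using assms by (intro power_strict_mono) auto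
  then have e: "0 < \<epsilon>" "\<epsilon> \<le> 1 / 4" "\<epsilon> \<le> r\<^sup>2 - \<delta>\<^sup>2" "\<epsilon> \<le> \<delta>\<^sup>2 / ?k"
    using \<open>0 < \<delta>\<close> k unfolding \<epsilon>_def
    by (simp, intro min.coboundedI1 min.cobounded1, intro min.cobounded2,
        intro min.coboundedI1 min.cobounded2)
  have "\<epsilon> * (2 * real CARD('n) + \<mu>) \<le> \<epsilon> * ?k" using e by (intro mult_left_mono) auto
  also have "\<dots> \<le> \<delta>\<^sup>2" using e(4) k by (simp add: pos_le_divide_eq)
  also have "\<dots> < 2 * \<delta>\<^sup>2" using assms by simp
  finally have e': "\<epsilon> * (2 * real CARD('n) + \<mu>) < 2 * \<delta>\<^sup>2" .
  have rho2: "\<rho>\<^sup>2 = \<delta>\<^sup>2 + \<epsilon>" and rho: "0 \<le> \<rho>"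
    using e by (auto simp: \<rho>_def)
  have "\<delta> < \<rho>" unfolding \<rho>_def using e by (intro real_less_rsqrt) simp
  have "\<rho> \<le> r" unfolding \<rho>_def using e assms by (intro real_le_lsqrt) auto
  let ?\<psi> = "bump y (\<rho>\<^sup>2)"
  let ?h = "\<lambda>x. w x * laplacian ?\<psi> x - \<mu> * (w x * ?\<psi> x)"
  have out: "?\<psi> x = 0" if "\<rho> \<le> norm (x - y)" for x
    using bump_eq_0 rho that by blast
  have lapout: "laplacian ?\<psi> x = 0" if "\<rho> \<le> norm (x - y)" for x
    using laplacian_bump_eq_0 rho that by blast
  have sub: "\<mu> * ?\<psi> x < laplacian ?\<psi> x" if "\<delta> \<le> norm (x - y)" "norm (x - y) < \<rho>" for x
    unfolding rho2 using that rho rho2[symmetric]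
    by (intro bump_subsolution assms e e') (auto intro: power_strict_mono)
  have *: "integrable lborel (\<lambda>x. w x * laplacian ?\<psi> x)" "integrable lborel (\<lambda>x. w x * ?\<psi> x)"
    "(\<integral>x. w x * laplacian ?\<psi> x \<partial>lborel) \<le> \<mu> * (\<integral>x. w x * ?\<psi> x \<partial>lborel)"
    using super[OF bump_test_function bump_nonneg] out \<open>\<rho> \<le> r\<close>
    by (force simp: dist_norm norm_minus_commute)+
  \<comment> \<open>The integrand is 0 on the inner ball because \<open>w\<close> is, 0 outside
    because the bump is, and a product of nonnegative factors in between. Its integral is at most 0,
    so it vanishes almost everywhere; on the annulus the second factor is positive, which leaves
    \<open>w = 0\<close>.\<close>
  have h0: "0 \<le> ?h x" for x
  proof -
    consider "norm (x - y) < \<delta>" | "\<delta> \<le> norm (x - y)" "norm (x - y) < \<rho>" | "\<rho> \<le> norm (x - y)"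
      by linarith
    then show ?thesis
    proof cases
      case 1 then show ?thesis using zero[of x] by (simp add: dist_norm norm_minus_commute)
    next
      case 2
      then have "0 \<le> w x * (laplacian ?\<psi> x - \<mu> * ?\<psi> x)"
        using nonneg[of x] sub[of x] \<open>\<rho> \<le> r\<close>
        by (intro mult_nonneg_nonneg) (auto simp: dist_norm norm_minus_commute)
      then show ?thesis by (simp add: algebra_simps)
    next
      case 3 then show ?thesis by (simp add: out lapout)
    qed
  qed
  have int: "integrable lborel ?h" using * by simp
  have "integral\<^sup>L lborel ?h \<le> 0" using * by simp
  then have "integral\<^sup>L lborel ?h = 0"
    using h0 by (intro antisym Bochner_Integration.integral_nonneg) auto
  then have "AE x in lborel. ?h x = 0"
    using integral_nonneg_eq_0_iff_AE[OF int] h0 by simp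
  then have "AE x in lborel. x \<in> ball y \<rho> \<longrightarrow> w x = 0"
  proof (rule AE_mp, intro AE_I2 impI)
    fix x assume h: "?h x = 0" and "x \<in> ball y \<rho>"
    then have x: "norm (x - y) < \<rho>" by (simp add: dist_norm norm_minus_commute)
    show "w x = 0"
    proof (cases "norm (x - y) < \<delta>")
      case True then show ?thesis using zero[of x] by (simp add: dist_norm norm_minus_commute)
    next
      case False
      then have "laplacian ?\<psi> x - \<mu> * ?\<psi> x > 0" using sub[of x] x by simp
      moreover have "w x * (laplacian ?\<psi> x - \<mu> * ?\<psi> x) = 0" using h by (simp add: algebra_simps)
      ultimately show ?thesis by simp
    qed
  qed
  then show thesis using that \<open>\<delta> < \<rho>\<close> \<open>\<rho> \<le> r\<close> by blast
qed

text \<open>A nonempty open set is not a null set. This turns the almost everywhere conclusion of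
  the maximum principle into an actual point.\<close>

lemma AE_lborel_open_witness:
  assumes "open U" "x0 \<in> U" "AE x in lborel. x \<in> U \<longrightarrow> P x"
  obtains x :: "'a::euclidean_space" where "x \<in> U" "P x"
proof (rule ccontr)
  assume "\<not> thesis"
  then have "AE x in lborel. x \<notin> U" using assms(3) that by auto
  then have "U \<in> null_sets lborel"
    using assms(1) by (subst AE_iff_null_sets) auto
  then have "negligible U"
    by (simp add: negligible_iff_null_sets null_sets_completionI)
  then show False using open_not_negligible assms by blast
qed

text \<open>Otherwise u^2 plus a multiple of the indicator of a ball would dominate a positive
  constant, which is not integrable over the whole space. For monotone profiles this acts as decay
  at infinity.\<close>

lemma Lp_space_two_not_bounded_below:
  fixes u :: "real ^ 'n::finite \<Rightarrow> real"
  assumes "u \<in> Lp_space 2" "0 < c"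
  shows "\<exists>x. r \<le> norm x \<and> \<bar>u x\<bar> < c"
proof (rule ccontr)
  assume "\<not> ?thesis"
  then have le: "c \<le> \<bar>u x\<bar>" if "r \<le> norm x" for x using that by force
  have "integrable lborel (\<lambda>x::real ^ 'n. c\<^sup>2)"
  proof (rule Bochner_Integration.integrable_bound)
    show "integrable lborel (\<lambda>x. (norm (u x))\<^sup>2 + c\<^sup>2 * indicator (cball 0 r) x)"
      using assms(1) unfolding Lp_space_two_iff
      by (intro Bochner_Integration.integrable_add integrable_mult_right integrable_real_indicator
          emeasure_bounded_finite) auto
    have "c\<^sup>2 \<le> (norm (u x))\<^sup>2 + c\<^sup>2 * indicator (cball 0 r) x" for x
      using power_mono[OF le, of x 2] assms(2) by (cases "norm x \<le> r") auto
    then show "AE x in lborel. norm (c\<^sup>2) \<le> norm ((norm (u x))\<^sup>2 + c\<^sup>2 * indicator (cball 0 r) x)"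
      by (intro always_eventually allI) (simp add: abs_of_nonneg)
  qed auto
  then have "integrable lborel (indicator UNIV :: real ^ 'n \<Rightarrow> real)"
    using assms(2) integrable_mult_right_iff[of lborel "\<lambda>x::real ^ 'n. 1" "c\<^sup>2"]
    by (simp add: indicator_def[abs_def])
  then show False by (simp only: integrable_indicator_iff) simp
qed

text \<open>Only right-hand difference quotients are used, so the endpoint \<open>a\<close> is
  included.\<close>

lemma mono_on_imp_deriv_nonneg_at_least:
  fixes F :: "real \<Rightarrow> real"
  assumes "mono_on {a..} F" "(F has_real_derivative D) (at t)" "a \<le> t"
  shows "0 \<le> D"
proof (rule tendsto_lowerbound)
  show "((\<lambda>h. (F (t + h) - F t) / h) \<longlongrightarrow> D) (at_right 0)"
    using assms(2) by (auto simp: DERIV_def intro: tendsto_mono at_le)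
  show "\<forall>\<^sub>F h in at_right 0. 0 \<le> (F (t + h) - F t) / h"
    unfolding eventually_at_filter
    using assms by (intro always_eventually) (auto simp: monotone_on_def)
qed simp

section \<open>Radially nonincreasing solutions\<close>

text \<open>The nonlinearity is a general \<open>g\<close>, so that both \<open>u\<close> with F'
  and \<open>- u\<close> with the reflected nonlinearity are instances.\<close>

locale antitone_radial_solution =
  fixes u :: "real ^ 'n::finite \<Rightarrow> real" and \<phi> g :: "real \<Rightarrow> real" and \<mu> :: real
  assumes L2: "u \<in> Lp_space 2" and nontrivial: "Lp_norm 2 u \<noteq> 0"
    and radial: "u x = \<phi> (norm x)" and antitone: "antimono_on {0..} \<phi>"
    and mu: "0 \<le> \<mu>" and solution: "distributional_solution \<mu> g u"
    and g_nonneg: "0 \<le> t \<Longrightarrow> 0 \<le> g t"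
begin

text \<open>An arbitrary unit coordinate vector, along which ball centres and witness points are
  placed.\<close>

abbreviation e :: "real ^ 'n" where "e \<equiv> axis undefined 1"

lemma antitoneD: "0 \<le> r \<Longrightarrow> r \<le> s \<Longrightarrow> \<phi> s \<le> \<phi> r"
  using antitone by (auto simp: monotone_on_def)

lemma exists_below: "0 < c \<Longrightarrow> 0 \<le> r \<Longrightarrow> \<exists>s\<ge>r. \<bar>\<phi> s\<bar> < c"
  using Lp_space_two_not_bounded_below[OF L2] radial by metis

text \<open>A negative value would persist as an upper bound at all larger radii, against square
  integrability.\<close>

lemma profile_nonneg:
  assumes "0 \<le> r"
  shows "0 \<le> \<phi> r"
proof (rule ccontr)
  assume "\<not> 0 \<le> \<phi> r"
  then obtain s where "r \<le> s" "\<bar>\<phi> s\<bar> < - \<phi> r" using exists_below[of "- \<phi> r" r] assms by auto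
  then show False using antitoneD[of r s] assms by auto
qed

lemma measurable_u: "u \<in> borel_measurable borel"
  using L2 by (simp add: Lp_space_two_iff)

lemma profile_pos:
  assumes "0 \<le> r"
  shows "0 < \<phi> r"
proof (rule ccontr)
  assume "\<not> 0 < \<phi> r"
  define Z where "Z = {s. 0 \<le> s \<and> \<phi> s = 0}"
  \<comment> \<open>\<open>R\<close> is the radius beyond which \<open>u\<close> vanishes; the value
    at \<open>R\<close> itself is left open.\<close>
  define R where "R = Inf Z"
  have "r \<in> Z" using \<open>\<not> 0 < \<phi> r\<close> profile_nonneg[OF assms] assms by (simp add: Z_def)
  then have Z: "Z \<noteq> {}" "bdd_below Z" by (auto simp: Z_def intro: bdd_belowI[of _ 0])
  have "0 \<le> R" unfolding R_def using Z by (intro cInf_greatest) (auto simp: Z_def)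
  have above: "\<phi> s = 0" if "R < s" for s
  proof -
    obtain z where "z \<in> Z" "z < s" using cInf_lessD[of Z s] \<open>R < s\<close> Z unfolding R_def by blast
    then show ?thesis using antitoneD[of z s] profile_nonneg[of s] by (auto simp: Z_def)
  qed
  have below: "0 < \<phi> s" if "0 \<le> s" "s < R" for s
  proof -
    have "s \<notin> Z" using that Z cInf_lower[of s Z] by (auto simp: R_def)
    then show ?thesis using profile_nonneg[of s] that by (auto simp: Z_def)
  qed
  \<comment> \<open>With \<open>R = 0\<close> the function would vanish off the origin and have norm
    0.\<close>
  have "0 < R"
  proof (rule ccontr)
    assume "\<not> 0 < R"
    then have u0: "u x = 0" if "x \<noteq> 0" for x using above[of "norm x"] that \<open>0 \<le> R\<close> by (simp add: radial)
    have "AE x in lborel. norm (u x) powr 2 = 0"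
      using AE_lborel_singleton[of "0 :: real ^ 'n"] by eventually_elim (simp add: u0)
    then have "(\<integral>x. norm (u x) powr 2 \<partial>lborel) = 0" by (rule integral_eq_zero_AE)
    then show False using nontrivial by (simp add: Lp_norm_def)
  qed
  \<comment> \<open>The unit ball about this point touches the sphere of radius \<open>R\<close>
    from outside.\<close>
  let ?y = "(R + 1) *\<^sub>R e"
  obtain \<rho> where "1 < \<rho>" and ae: "AE x in lborel. x \<in> ball ?y \<rho> \<longrightarrow> u x = 0"
  proof (rule strong_maximum_principle[of 1 2 \<mu> ?y u])
    show "u x = 0" if "x \<in> ball ?y 1" for x
    proof -
      have "norm ?y \<le> norm x + norm (?y - x)" using norm_triangle_ineq[of x "?y - x"] by simp
      then have "R < norm x" using that \<open>0 < R\<close> by (simp add: dist_norm norm_axis_1)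
      then show ?thesis using above by (simp add: radial)
    qed
    fix \<psi> :: "real ^ 'n \<Rightarrow> real"
    assume psi: "\<psi> \<in> test_functions" and psi0: "\<And>x. 0 \<le> \<psi> x"
    have i: "integrable lborel (\<lambda>x. u x * \<psi> x)" by (rule integrable_L2_mult_test[OF L2 psi])
    have gi: "integrable lborel (\<lambda>x. g (u x) * \<psi> x)"
      and eq: "(\<integral>x. u x * laplacian \<psi> x \<partial>lborel) = (\<integral>x. \<mu> * u x * \<psi> x - g (u x) * \<psi> x \<partial>lborel)"
      using solution psi by (auto simp: distributional_solution_def)
    have "0 \<le> (\<integral>x. g (u x) * \<psi> x \<partial>lborel)"
      using psi0 by (intro Bochner_Integration.integral_nonneg) (auto simp: radial g_nonneg profile_nonneg)
    then have "(\<integral>x. u x * laplacian \<psi> x \<partial>lborel) \<le> \<mu> * (\<integral>x. u x * \<psi> x \<partial>lborel)"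
      unfolding eq using i gi by (simp add: mult.assoc)
    then show "integrable lborel (\<lambda>x. u x * laplacian \<psi> x) \<and> integrable lborel (\<lambda>x. u x * \<psi> x) \<and>
        (\<integral>x. u x * laplacian \<psi> x \<partial>lborel) \<le> \<mu> * (\<integral>x. u x * \<psi> x \<partial>lborel)"
      using i integrable_L2_mult_laplacian[OF L2 psi] by simp
  qed (use mu measurable_u profile_nonneg in \<open>auto simp: radial\<close>)
  \<comment> \<open>The enlarged ball crosses the sphere, so \<open>u\<close> would vanish at points
    of norm below \<open>R\<close>, where it is positive.\<close>
  let ?U = "ball ?y \<rho> \<inter> ball 0 R"
  have "max 0 (R + 1 - \<rho>) < R" using \<open>0 < R\<close> \<open>1 < \<rho>\<close> by simp
  then obtain t where t: "max 0 (R + 1 - \<rho>) < t" "t < R" using dense by blast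
  have "?y - t *\<^sub>R e = (R + 1 - t) *\<^sub>R e" by (simp add: scaleR_diff_left)
  then have "t *\<^sub>R e \<in> ?U" using t by (simp add: dist_norm norm_axis_1)
  moreover have "open ?U" by auto
  moreover have "AE x in lborel. x \<in> ?U \<longrightarrow> u x = 0" using ae by eventually_elim simp
  ultimately obtain x where "x \<in> ?U" "u x = 0"
    using AE_lborel_open_witness[of ?U "t *\<^sub>R e" "\<lambda>x. u x = 0"] by blast
  then show False using below[of "norm x"] by (simp add: radial)
qed

text \<open>Testing with a bump supported in the annulus makes \<open>u\<close> a constant c under
  the integral. The Laplacian side is then 0, and (\<mu> c - g(c)) times the positive integral of
  the bump remains.\<close>

lemma eq_on_plateau:
  assumes "0 \<le> r1" "r1 < r2" "\<phi> r1 = \<phi> r2"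
  shows "g (\<phi> r1) = \<mu> * \<phi> r1"
proof -
  let ?c = "\<phi> r1"
  \<comment> \<open>Half the width of the annulus: the ball of this radius about a point midway is
    inscribed in it.\<close>
  define \<delta> where "\<delta> = (r2 - r1) / 2"
  define y where "y = ((r1 + r2) / 2) *\<^sub>R e"
  let ?\<psi> = "bump y (\<delta>\<^sup>2)"
  have "0 < \<delta>" using assms by (simp add: \<delta>_def)
  have ny: "norm y = (r1 + r2) / 2" using assms by (simp add: y_def norm_axis_1)
  have u: "u x = ?c" if "norm (x - y) < \<delta>" for x
  proof -
    have "\<bar>norm x - norm y\<bar> < \<delta>" using norm_triangle_ineq3[of x y] that by simp
    then have "r1 \<le> norm x" "norm x \<le> r2" unfolding ny \<delta>_def by (auto simp: field_simps abs_less_iff)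
    then show ?thesis using antitoneD[of r1 "norm x"] antitoneD[of "norm x" r2] assms by (simp add: radial)
  qed
  have "(\<integral>x. u x * laplacian ?\<psi> x \<partial>lborel) = (\<integral>x. ?c * laplacian ?\<psi> x \<partial>lborel)"
  proof (intro Bochner_Integration.integral_cong refl)
    show "u x * laplacian ?\<psi> x = ?c * laplacian ?\<psi> x" for x
      using u[of x] laplacian_bump_eq_0[of \<delta> x y] \<open>0 < \<delta>\<close> by (cases "norm (x - y) < \<delta>") simp_all
  qed
  also have "\<dots> = 0" by (simp add: integral_laplacian_test bump_test_function)
  finally have "(\<integral>x. \<mu> * u x * ?\<psi> x - g (u x) * ?\<psi> x \<partial>lborel) = 0"
    using solution[unfolded distributional_solution_def, rule_format, OF bump_test_function[of y "\<delta>\<^sup>2"]]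
    by simp
  also have "(\<integral>x. \<mu> * u x * ?\<psi> x - g (u x) * ?\<psi> x \<partial>lborel) = (\<integral>x. (\<mu> * ?c - g ?c) * ?\<psi> x \<partial>lborel)"
  proof (intro Bochner_Integration.integral_cong refl)
    show "\<mu> * u x * ?\<psi> x - g (u x) * ?\<psi> x = (\<mu> * ?c - g ?c) * ?\<psi> x" for x
      using u[of x] bump_eq_0[of \<delta> x y] \<open>0 < \<delta>\<close>
      by (cases "norm (x - y) < \<delta>") (auto simp: left_diff_distrib)
  qed
  finally have "(\<mu> * ?c - g ?c) * (\<integral>x. ?\<psi> x \<partial>lborel) = 0" by simp
  moreover have "(\<integral>x. ?\<psi> x \<partial>lborel) \<noteq> 0"
  proof
    assume "(\<integral>x. ?\<psi> x \<partial>lborel) = 0"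
    then have ae: "AE x in lborel. ?\<psi> x = 0"
      using integral_nonneg_eq_0_iff_AE[OF test_function_integrable[OF bump_test_function[of y "\<delta>\<^sup>2"]]]
      by (simp add: bump_nonneg)
    obtain x where "x \<in> ball y \<delta>" "?\<psi> x = 0"
      by (rule AE_lborel_open_witness[of "ball y \<delta>" y "\<lambda>x. ?\<psi> x = 0"]) (use ae \<open>0 < \<delta>\<close> in auto)
    then show False
      using power_strict_mono[of "norm (x - y)" \<delta> 2]
      by (simp add: bump_def flat_exp_def dist_norm norm_minus_commute)
  qed
  ultimately show ?thesis by simp
qed

lemma profile_strict:
  assumes g_le: "\<And>t. 0 \<le> t \<Longrightarrow> t \<le> t\<^sub>0 \<Longrightarrow> g t \<le> \<mu> * t" and g_gt: "\<And>t. t\<^sub>0 < t \<Longrightarrow> \<mu> * t < g t"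
  shows "strict_antimono_on {0..} \<phi>"
proof (rule monotone_onI, rule ccontr)
  fix r1 r2 :: real
  assume "r1 \<in> {0..}" and "r1 < r2" and "\<not> \<phi> r2 < \<phi> r1"
  then have r: "0 \<le> r1" "r1 < r2" and eq: "\<phi> r1 = \<phi> r2" using antitoneD[of r1 r2] by auto
  define c where "c = \<phi> r1"
  have "0 < c" using profile_pos r by (simp add: c_def)
  have "c \<le> t\<^sub>0" using eq_on_plateau[OF r eq] g_gt[of c] by (force simp: c_def)
  define C where "C = {s. r1 \<le> s \<and> \<phi> s = c}"
  define R where "R = Sup C"
  \<comment> \<open>Square integrability makes the profile drop below \<open>c\<close>, so the
    plateau has a finite outer radius \<open>R\<close>.\<close>
  obtain b where b: "r1 \<le> b" "\<bar>\<phi> b\<bar> < c" using exists_below[OF \<open>0 < c\<close> r(1)] by auto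
  have "s \<le> b" if "s \<in> C" for s
    using that b antitoneD[of b s] r by (force simp: C_def)
  then have C: "bdd_above C" "r2 \<in> C" using eq r by (force intro: bdd_aboveI, simp add: C_def c_def)
  then have "r2 \<le> R" unfolding R_def by (intro cSup_upper)
  have inside: "\<phi> s = c" if "r1 \<le> s" "s < R" for s
  proof -
    obtain z where "z \<in> C" "s < z" using less_cSupD[of C s] \<open>s < R\<close> C unfolding R_def by blast
    then show ?thesis using antitoneD[of s z] antitoneD[of r1 s] r that by (auto simp: C_def c_def)
  qed
  have outside: "\<phi> s < c" if "R < s" for s
  proof -
    have "s \<notin> C" using that C cSup_upper[of s C] by (auto simp: R_def)
    then show ?thesis using antitoneD[of r1 s] r \<open>r2 \<le> R\<close> that by (auto simp: C_def c_def)
  qed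
  \<comment> \<open>The ball of radius \<open>d\<close> about a point at radius \<open>R - d\<close>
    touches the outer sphere from inside. The doubled ball stays at radii above
    \<open>R - 3 * d\<close>, hence beyond \<open>r1\<close>, where
    \<open>u \<le> c\<close>.\<close>
  define d where "d = (R - r1) / 4"
  have d: "0 < d" "r1 = R - 4 * d" using r \<open>r2 \<le> R\<close> by (auto simp: d_def field_simps)
  define y where "y = (R - d) *\<^sub>R e"
  have ny: "norm y = R - d" using r d by (simp add: y_def norm_axis_1)
  have ball: "r1 < norm x" if "x \<in> ball y (2 * d)" for x
    using norm_triangle_ineq2[of y x] that d ny by (simp add: dist_norm)
  obtain \<rho> where "d < \<rho>" and ae: "AE x in lborel. x \<in> ball y \<rho> \<longrightarrow> c - u x = 0"
  \<comment> \<open>The parameter is 0 because \<open>c - u\<close> is superharmonic on the doubled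
    ball: there 0 \<le> u \<le> c \<le> \<open>t\<^sub>0\<close>, so \<mu> u - g(u) \<ge> 0.\<close>
  proof (rule strong_maximum_principle[of d "2 * d" 0 y "\<lambda>x. c - u x"])
    show "0 \<le> c - u x" if "x \<in> ball y (2 * d)" for x
      using ball[OF that] antitoneD[of r1 "norm x"] r by (simp add: radial c_def)
    show "c - u x = 0" if "x \<in> ball y d" for x
    proof -
      have "norm x < R" using norm_triangle_ineq2[of x y] that ny by (simp add: dist_norm norm_minus_commute)
      moreover have "r1 < norm x" using that d by (intro ball) simp
      ultimately show ?thesis using inside by (simp add: radial)
    qed
    fix \<psi> :: "real ^ 'n \<Rightarrow> real"
    assume psi: "\<psi> \<in> test_functions" and psi0: "\<And>x. 0 \<le> \<psi> x"
      and supp: "\<And>x. x \<notin> ball y (2 * d) \<Longrightarrow> \<psi> x = 0"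
    have eq: "(\<integral>x. u x * laplacian \<psi> x \<partial>lborel) = (\<integral>x. \<mu> * u x * \<psi> x - g (u x) * \<psi> x \<partial>lborel)"
      using solution psi by (auto simp: distributional_solution_def)
    have "0 \<le> \<mu> * u x * \<psi> x - g (u x) * \<psi> x" for x
    proof (cases "x \<in> ball y (2 * d)")
      case True
      then have "u x \<le> c" "0 \<le> u x"
        using ball[OF True] antitoneD[of r1 "norm x"] r by (auto simp: radial c_def profile_nonneg)
      then have "0 \<le> (\<mu> * u x - g (u x)) * \<psi> x" using g_le[of "u x"] psi0[of x] \<open>c \<le> t\<^sub>0\<close> by simp
      then show ?thesis by (simp add: left_diff_distrib)
    qed (simp add: supp)
    then have "0 \<le> (\<integral>x. u x * laplacian \<psi> x \<partial>lborel)"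
      unfolding eq by (intro Bochner_Integration.integral_nonneg) auto
    moreover have "integrable lborel (\<lambda>x. u x * laplacian \<psi> x)" "integrable lborel (\<lambda>x. u x * \<psi> x)"
      by (rule integrable_L2_mult_laplacian[OF L2 psi] integrable_L2_mult_test[OF L2 psi])+
    ultimately show "integrable lborel (\<lambda>x. (c - u x) * laplacian \<psi> x) \<and>
        integrable lborel (\<lambda>x. (c - u x) * \<psi> x) \<and>
        (\<integral>x. (c - u x) * laplacian \<psi> x \<partial>lborel) \<le> 0 * (\<integral>x. (c - u x) * \<psi> x \<partial>lborel)"
      using psi by (simp add: left_diff_distrib integrable_laplacian_test test_function_integrable
          integral_laplacian_test)
  qed (use d measurable_u in auto)
  \<comment> \<open>The enlarged ball reaches past the outer sphere, where the profile is strictly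
    below \<open>c\<close>.\<close>
  let ?U = "ball y \<rho> \<inter> - cball 0 R"
  obtain t where t: "R < t" "t < R - d + \<rho>" using dense[of R "R - d + \<rho>"] \<open>d < \<rho>\<close> by auto
  have "y - t *\<^sub>R e = (R - d - t) *\<^sub>R e" by (simp add: y_def scaleR_diff_left)
  then have "t *\<^sub>R e \<in> ?U" using t d r by (simp add: dist_norm norm_axis_1)
  moreover have "open ?U" by auto
  moreover have "AE x in lborel. x \<in> ?U \<longrightarrow> c - u x = 0" using ae by eventually_elim simp
  ultimately obtain x where "x \<in> ?U" "c - u x = 0"
    using AE_lborel_open_witness[of ?U "t *\<^sub>R e" "\<lambda>x. c - u x = 0"] by blast
  then show False using outside[of "norm x"] by (simp add: radial)
qed

end

section \<open>Conclusion for both directions of monotonicity\<close>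

theorem proposition1p2:
  fixes F :: "real \<Rightarrow> real" and a \<mu> :: real and u :: "real ^ 'n::finite \<Rightarrow> real"
  assumes "a > 0"
    and "F0 CARD('n) F"
    and "eta_infinity CARD('n) F < \<infinity>"
    and "((\<lambda>t. F t / t\<^sup>2) \<longlongrightarrow> 0) (at 0)"
    and "eta_zero CARD('n) F > 0"
    and "2 * eta_infinity CARD('n) F
           * ereal (GN_constant TYPE('n) powr two_sharp CARD('n) * a powr (4 / real CARD('n))) < 1"
    and "eta_zero CARD('n) F = \<infinity> \<or>
         2 * eta_zero CARD('n) F
           * ereal (GN_constant TYPE('n) powr two_sharp CARD('n) * a powr (4 / real CARD('n))) > 1"
    and "CARD('n) \<ge> 2 \<or> locally_lipschitz (deriv F) \<or> (\<forall>t. F (- t) = F t)"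
    and "\<mu> > 0"
    and "u \<in> L2_sphere a"
    and "weak_solution \<mu> (deriv F) u"
    and "energy F u < 0"
    and "ereal (energy F u) = (INF v \<in> (L2_ball a :: (real ^ 'n \<Rightarrow> real) set). ereal (energy F v))"
    and "ereal (energy F u) = (INF v \<in> (L2_sphere a :: (real ^ 'n \<Rightarrow> real) set). ereal (energy F v))"
    and "radially_monotone u"
    and "mono_on {0..} F" and "antimono_on {..0} F"
  shows "(\<forall>x. \<bar>u x\<bar> > 0) \<and>
    ((\<exists>t\<^sub>0>0. \<exists>s\<^sub>0>0.
        (\<forall>t\<in>{0..t\<^sub>0}. deriv F t \<le> \<mu> * t) \<and> (\<forall>t>t\<^sub>0. deriv F t > \<mu> * t) \<and>
        (\<forall>t\<in>{- s\<^sub>0..0}. deriv F t \<ge> \<mu> * t) \<and> (\<forall>t<(- s\<^sub>0). deriv F t < \<mu> * t))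
      \<longrightarrow> radially_strictly_monotone u)"
proof -
  have dF: "(F has_real_derivative deriv F t) (at t)" for t
    using assms(2) by (auto simp: F0_def C1_differentiable_on_eq DERIV_deriv_iff_real_differentiable)
  \<comment> \<open>Monotonicity of \<open>F\<close> on the two half-lines enters through the sign
    of its derivative.\<close>
  have f_pos: "0 \<le> deriv F t" if "0 \<le> t" for t
    using mono_on_imp_deriv_nonneg_at_least[OF assms(16) dF that] .
  have f_neg: "0 \<le> - deriv F (- t)" if "0 \<le> t" for t
  proof (rule mono_on_imp_deriv_nonneg_at_least[OF _ _ that])
    show "mono_on {0..} (\<lambda>t. F (- t))" using assms(17) by (auto simp: monotone_on_def)
    show "((\<lambda>t. F (- t)) has_real_derivative - deriv F (- t)) (at t)"
      using dF[of "- t"] by (simp add: DERIV_mirror)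
  qed
  have sol: "distributional_solution \<mu> (deriv F) u"
    using assms(11) by (rule weak_solution_imp_distributional)
  have u: "u \<in> Lp_space 2" "Lp_norm 2 u = a"
    using assms(10) by (auto simp: L2_sphere_def H1_def)
  obtain \<phi> where phi: "\<And>x. u x = \<phi> (norm x)" and "mono_on {0..} \<phi> \<or> antimono_on {0..} \<phi>"
    using assms(15) by (auto simp: radially_monotone_def)
  then show ?thesis
  proof (elim disjE)
    assume anti: "antimono_on {0..} \<phi>"
    interpret antitone_radial_solution u \<phi> "deriv F" \<mu>
      by unfold_locales (use u phi anti assms(1,9) sol f_pos in auto)
    show ?thesis
    proof (intro conjI allI impI)
      show "\<bar>u x\<bar> > 0" for x using profile_pos[of "norm x"] by (simp add: phi)
      assume "\<exists>t\<^sub>0>0. \<exists>s\<^sub>0>0.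
        (\<forall>t\<in>{0..t\<^sub>0}. deriv F t \<le> \<mu> * t) \<and> (\<forall>t>t\<^sub>0. deriv F t > \<mu> * t) \<and>
        (\<forall>t\<in>{- s\<^sub>0..0}. deriv F t \<ge> \<mu> * t) \<and> (\<forall>t<(- s\<^sub>0). deriv F t < \<mu> * t)"
      then obtain t\<^sub>0 where t0: "\<forall>t\<in>{0..t\<^sub>0}. deriv F t \<le> \<mu> * t" "\<forall>t>t\<^sub>0. deriv F t > \<mu> * t"
        by blast
      have "strict_antimono_on {0..} \<phi>" by (rule profile_strict[of t\<^sub>0]) (use t0 in auto)
      then show "radially_strictly_monotone u"
        unfolding radially_strictly_monotone_def using phi by blast
    qed
  next
    assume mono: "mono_on {0..} \<phi>"
    \<comment> \<open>The reflected nonlinearity carries the conditions on the negative half-line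
      over to the positive one, with \<open>s\<^sub>0\<close> as threshold.\<close>
    interpret antitone_radial_solution "\<lambda>x. - u x" "\<lambda>r. - \<phi> r" "\<lambda>t. - deriv F (- t)" \<mu>
    proof unfold_locales
      show "(\<lambda>x. - u x) \<in> Lp_space 2" "Lp_norm 2 (\<lambda>x. - u x) \<noteq> 0"
        using u assms(1) by (auto simp: Lp_space_def Lp_norm_def)
      show "antimono_on {0..} (\<lambda>r. - \<phi> r)" using mono by (auto simp: monotone_on_def)
    qed (use phi assms(9) f_neg distributional_solution_uminus[OF sol] in auto)
    show ?thesis
    proof (intro conjI allI impI)
      show "\<bar>u x\<bar> > 0" for x using profile_pos[of "norm x"] by (simp add: phi)
      assume "\<exists>t\<^sub>0>0. \<exists>s\<^sub>0>0.
        (\<forall>t\<in>{0..t\<^sub>0}. deriv F t \<le> \<mu> * t) \<and> (\<forall>t>t\<^sub>0. deriv F t > \<mu> * t) \<and>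
        (\<forall>t\<in>{- s\<^sub>0..0}. deriv F t \<ge> \<mu> * t) \<and> (\<forall>t<(- s\<^sub>0). deriv F t < \<mu> * t)"
      then obtain s\<^sub>0 where s0: "\<And>t. t \<in> {- s\<^sub>0..0} \<Longrightarrow> \<mu> * t \<le> deriv F t" "\<And>t. t < - s\<^sub>0 \<Longrightarrow> deriv F t < \<mu> * t"
        by blast
      have "strict_antimono_on {0..} (\<lambda>r. - \<phi> r)"
      proof (rule profile_strict)
        show "- deriv F (- t) \<le> \<mu> * t" if "0 \<le> t" "t \<le> s\<^sub>0" for t using s0(1)[of "- t"] that by simp
        show "\<mu> * t < - deriv F (- t)" if "s\<^sub>0 < t" for t using s0(2)[of "- t"] that by simp
      qed
      then have "strict_mono_on {0..} \<phi>" by (auto simp: monotone_on_def)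
      then show "radially_strictly_monotone u"
        unfolding radially_strictly_monotone_def using phi by blast
    qed
  qed
qed

end
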